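(* Let $X$ be a real-valued, positive random variable on a probability space $(\mathcal X,\mu)$ whose moment generating function $g(\xi)=\mathbf{E}^\mu[e^{\xi X}]$ is finite for $\xi$ in some open set $(-\infty,\xi^\ast)$, where $\xi^\ast>0$. For any $y>\mathbf{E}^\mu[X]$, the following inequality holds: $$\mu(X\ge y)\;\ge\;\sup_{1<\alpha<\delta} L(\alpha,\delta,y),$$ where $$L(\alpha,\delta,y)=\left(1-e^{-I_\alpha(\delta y)}-e^{-I_\alpha(y)}\right)\exp\left\{-I_\mu(\alpha y)-\Xi(\alpha y)\,y\,(\delta-\alpha)\right\}.$$ Moreover, there exist feasible values of $\alpha$ and $\delta$ (that is, $1<\alpha<\delta$) which make the right-hand side strictly positive, i.e. for which $L(\alpha,\delta,y)>0$.
   Context: $X$ is a real-valued, positive random variable on a probability space $(\mathcal X,\mu)$ with exponential moments: $g(\xi)=\mathbf{E}^\mu[e^{\xi X}]<\infty$ for $\xi$ in some open set $(-\infty,\xi^\ast)$, where $\xi^\ast>0$. The rate function is the Legendre transform of the cumulant (the logarithm of the moment generating function): $I_\mu(t)=\sup_\xi\{\xi t-\log g(\xi)\}$. The corresponding Legendre dual is $\Xi(t)=\arg\sup_{\xi\ge 0}\{\xi t-\log g(\xi)\}$ if $t\ge \mathbf{E}^\mu[X]$, and $\Xi(t)=\arg\sup_{\xi\le 0}\{\xi t-\log g(\xi)\}$ if $t<\mathbf{E}^\mu[X]$. The exponentially tilted probability measure is $\nu_\xi(dt)=g(\xi)^{-1}e^{\xi t}\mu(dt)$, where $\mu(dt)$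 denotes the law of $X$. For the given $y$, $I_\alpha$ denotes the rate function of the tilted measure $\nu_{\Xi(\alpha y)}$, that is, $I_\alpha(t)=\sup_\theta\{\theta t-\log \mathbf{E}[e^{\theta Y}]\}$, where $Y$ is a random variable with law $\nu_{\Xi(\alpha y)}$. So $I_\alpha$ depends on $y$ as well as on $\alpha$.
   Formalization: The "moreover" claim fails in general (X uniform on {1,2}, y=3 gives L≤0), so it is proved under the added necessary condition that Ξ(y)<ζ for some real ζ with g(ζ)<∞; where the arg sup is not attained, Ξ is read as +∞ and L as 0. *)

theory Defs
  imports "HOL-Probability.Probability"
begin

definition mgf :: "'a measure \<Rightarrow> ('a \<Rightarrow> real) \<Rightarrow> real \<Rightarrow> ennreal" where
  "mgf M X \<xi> = (\<integral>\<^sup>+ x. ennreal (exp (\<xi> * X x)) \<partial>M)"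

(* log g, with value \<infinity> where g is infinite. (For a probability measure g is never 0.) *)
definition cgf :: "'a measure \<Rightarrow> ('a \<Rightarrow> real) \<Rightarrow> real \<Rightarrow> ereal" where
  "cgf M X \<xi> = (if mgf M X \<xi> = \<infinity> then \<infinity> else ereal (ln (enn2real (mgf M X \<xi>))))"

definition rate_function :: "'a measure \<Rightarrow> ('a \<Rightarrow> real) \<Rightarrow> real \<Rightarrow> ereal" where
  "rate_function M X t = (SUP \<xi>. ereal (\<xi> * t) - cgf M X \<xi>)"

(* The arg sup is taken in the extended reals: if no real \<xi> attains the supremum, then the
   supremum is only approached as \<xi> tends to \<infinity> (case t \<ge> E[X]) or to -\<infinity> (case t < E[X]),
   and this infinite value is the arg sup. *)
definition legendre_dual :: "'a measure \<Rightarrow> ('a \<Rightarrow> real) \<Rightarrow> real \<Rightarrow> ereal" where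
  "legendre_dual M X t =
    (let f = (\<lambda>\<xi>. ereal (\<xi> * t) - cgf M X \<xi>) in
     if t \<ge> integral\<^sup>L M X
     then (if \<exists>\<xi>. is_arg_max f (\<lambda>\<xi>. \<xi> \<ge> 0) \<xi> then ereal (arg_max f (\<lambda>\<xi>. \<xi> \<ge> 0)) else \<infinity>)
     else (if \<exists>\<xi>. is_arg_max f (\<lambda>\<xi>. \<xi> \<le> 0) \<xi> then ereal (arg_max f (\<lambda>\<xi>. \<xi> \<le> 0)) else -\<infinity>))"

definition tilted_law :: "'a measure \<Rightarrow> ('a \<Rightarrow> real) \<Rightarrow> real \<Rightarrow> real measure" where
  "tilted_law M X \<xi> =
    density (distr M borel X) (\<lambda>t. ennreal (exp (\<xi> * t)) / mgf M X \<xi>)"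

(* I_\<alpha>(t), for the given y; the identity on the reals is a random variable with the tilted law.
   There is no tilted law for an infinite dual; real_of_ereal then picks \<nu>_0, which is immaterial
   in L below because the exponential factor is 0 in that case. *)
definition tilted_rate_function ::
    "'a measure \<Rightarrow> ('a \<Rightarrow> real) \<Rightarrow> real \<Rightarrow> real \<Rightarrow> real \<Rightarrow> ereal" where
  "tilted_rate_function M X y \<alpha> t =
    rate_function (tilted_law M X (real_of_ereal (legendre_dual M X (\<alpha> * y)))) (\<lambda>u. u) t"

definition exp_ereal :: "ereal \<Rightarrow> ereal" where
  "exp_ereal x = (if x = \<infinity> then \<infinity> else if x = -\<infinity> then 0 else ereal (exp (real_of_ereal x)))"

definition L :: "'a measure \<Rightarrow> ('a \<Rightarrow> real) \<Rightarrow> real \<Rightarrow> real \<Rightarrow> real \<Rightarrow> ereal" where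
  "L M X \<alpha> \<delta> y =
    (1 - exp_ereal (- tilted_rate_function M X y \<alpha> (\<delta> * y))
       - exp_ereal (- tilted_rate_function M X y \<alpha> y)) *
    exp_ereal (- rate_function M X (\<alpha> * y)
               - legendre_dual M X (\<alpha> * y) * ereal y * ereal (\<delta> - \<alpha>))"

end

theory Submission
  imports Defs
begin

text \<open>
  Write \<open>g\<close> for the moment generating function, \<open>t = \<alpha> y\<close>, \<open>\<xi> = \<Xi>(t)\<close> and \<open>\<nu> = \<nu>\<^sub>\<xi>\<close>.

  The lower bound comes from a change of measure. On \<open>[y, \<delta> y]\<close> the density of \<open>\<mu>\<close> with respect to
  \<open>\<nu>\<close>, which is \<open>g(\<xi>) exp(-\<xi> u)\<close>, is at least \<open>g(\<xi>) exp(-\<xi> \<delta> y)\<close>, and this number is exactly the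
  exponential factor of \<open>L\<close> (\<open>L_attained\<close>). Hence \<open>\<mu>(X \<ge> y)\<close> is at least this factor times
  \<open>\<nu>[y, \<delta> y]\<close> (\<open>tilted_interval_le\<close>), and Chernoff bounds for \<open>\<nu>\<close> above \<open>\<delta> y\<close> and below \<open>y\<close> give the
  first factor.

  Chernoff's inequality with the full Legendre transform, a supremum over \<open>\<theta>\<close> of both signs, holds
  only on the correct side of the mean, and the mean of \<open>\<nu>\<close> can differ from \<open>\<alpha> y\<close> when \<open>\<xi>\<close> lies on
  the boundary of the domain of \<open>g\<close>. What replaces the mean is the maximality of \<open>\<xi>\<close> itself: it says
  that \<open>\<theta> \<alpha> y \<le> log E\<^sub>\<nu>[exp(\<theta> Y)]\<close> for every real \<open>\<theta>\<close> (\<open>legendre_attained_support\<close>), so that \<open>\<alpha> y\<close> is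
  a subgradient at \<open>0\<close>. Since \<open>y < \<alpha> y < \<delta> y\<close>, the values of \<open>\<theta>\<close> of the wrong sign then contribute
  nothing positive to either rate function (\<open>chernoff\<close>). If the supremum is not attained, the
  exponential factor vanishes and so does \<open>L\<close>.

  For positivity, \<open>\<Xi>(y)\<close> is assumed to lie to the left of a point \<open>\<zeta>\<close> where \<open>g\<close> is finite. The objective
  \<open>\<xi> y - log g(\<xi>)\<close> equals \<open>- log E[exp(\<xi> (X - y))]\<close>, and it cannot be constant from \<open>\<Xi>(y)\<close> on, as
  \<open>X\<close> would then be the constant \<open>y\<close>. It therefore drops strictly before \<open>\<zeta>\<close>, and still does so when
  \<open>y\<close> is replaced by a slightly larger \<open>\<alpha> y\<close>; this confines \<open>\<Xi>(\<alpha> y)\<close> to the left of \<open>\<zeta>\<close>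
  (\<open>legendre_attained_beyond\<close>). At such an interior point the cumulant function of \<open>\<nu>\<close> has only one
  subgradient at \<open>0\<close> (\<open>support_slope_unique\<close>), namely \<open>\<alpha> y\<close>. So \<open>y\<close> is not one, which means that
  \<open>I\<^sub>\<alpha>(y) > 0\<close>; and \<open>I\<^sub>\<alpha>(\<delta> y)\<close> tends to infinity with \<open>\<delta>\<close>, because \<open>\<nu>\<close> has a positive exponential
  moment (\<open>L_pos\<close>).
\<close>

section \<open>The extended exponential\<close>

lemma exp_ereal_simps [simp]:
  "exp_ereal (ereal r) = ereal (exp r)" "exp_ereal \<infinity> = \<infinity>" "exp_ereal (-\<infinity>) = 0"
  by (simp_all add: exp_ereal_def)

lemma exp_ereal_nonneg [simp]: "0 \<le> exp_ereal x"
  by (cases x) auto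

lemma exp_ereal_mono: "x \<le> y \<Longrightarrow> exp_ereal x \<le> exp_ereal y"
  by (cases x; cases y) auto

lemma exp_ereal_uminus_less_1: "0 < x \<Longrightarrow> exp_ereal (- x) < 1"
  by (cases x) (auto simp: one_ereal_def)

section \<open>Moment generating function and Legendre transform\<close>

context prob_space
begin

lemma mgf_pos:
  assumes [measurable]: "X \<in> borel_measurable M"
  shows "0 < mgf M X \<xi>"
proof -
  have "mgf M X \<xi> \<noteq> 0"
  proof
    assume "mgf M X \<xi> = 0"
    then have "AE x in M. ennreal (exp (\<xi> * X x)) = 0"
      unfolding mgf_def by (subst (asm) nn_integral_0_iff_AE) auto
    then have "AE x in M. False" by simp
    then show False by (simp add: AE_False)
  qed
  then show ?thesis by (simp add: zero_less_iff_neq_zero)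
qed

lemma mgf_finite:
  assumes [measurable]: "X \<in> borel_measurable M" and fin: "mgf M X \<xi> < \<infinity>"
  shows integrable_exp: "integrable M (\<lambda>x. exp (\<xi> * X x))"
    and mgf_eq_expectation: "mgf M X \<xi> = ennreal (expectation (\<lambda>x. exp (\<xi> * X x)))"
    and expectation_exp_pos: "0 < expectation (\<lambda>x. exp (\<xi> * X x))"
    and cgf_eq_ln_expectation: "cgf M X \<xi> = ereal (ln (expectation (\<lambda>x. exp (\<xi> * X x))))"
proof -
  show I: "integrable M (\<lambda>x. exp (\<xi> * X x))"
    using fin by (intro integrableI_nonneg) (auto simp: mgf_def)
  show E: "mgf M X \<xi> = ennreal (expectation (\<lambda>x. exp (\<xi> * X x)))"
    unfolding mgf_def by (intro nn_integral_eq_integral I) simp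
  show P: "0 < expectation (\<lambda>x. exp (\<xi> * X x))"
    using mgf_pos[of X \<xi>] E by simp
  show "cgf M X \<xi> = ereal (ln (expectation (\<lambda>x. exp (\<xi> * X x))))"
    using fin E P by (auto simp: cgf_def enn2real_ennreal)
qed

lemma integrable_exp_shifted:
  assumes [measurable]: "X \<in> borel_measurable M" and "mgf M X \<xi> < \<infinity>"
  shows "integrable M (\<lambda>x. exp (\<xi> * (X x - t)))"
  using integrable_exp[OF assms] by (simp add: right_diff_distrib exp_diff)

lemma expectation_exp_shifted:
  fixes X :: "'a \<Rightarrow> real"
  shows "expectation (\<lambda>x. exp (\<xi> * (X x - t))) = expectation (\<lambda>x. exp (\<xi> * X x)) / exp (\<xi> * t)"
  unfolding right_diff_distrib exp_diff by simp

lemma expectation_exp_shifted_pos: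
  assumes "X \<in> borel_measurable M" "mgf M X \<xi> < \<infinity>"
  shows "0 < expectation (\<lambda>x. exp (\<xi> * (X x - t)))"
  using expectation_exp_pos[OF assms] by (simp add: expectation_exp_shifted)

text \<open>
  Shifting \<open>X\<close> by \<open>t\<close> absorbs the linear term. Maximizing the objective thus becomes minimizing
  \<open>E[exp(\<xi> (X - t))]\<close>, whose convexity in \<open>\<xi>\<close> is inherited pointwise from \<open>exp\<close>; the convexity
  of the cumulant function, which would need Hoelder's inequality, is avoided.
\<close>

lemma legendre_objective:
  assumes "X \<in> borel_measurable M"
  shows "ereal (\<xi> * t) - cgf M X \<xi> =
    (if mgf M X \<xi> < \<infinity> then ereal (- ln (expectation (\<lambda>x. exp (\<xi> * (X x - t))))) else -\<infinity>)"
proof (cases "mgf M X \<xi> < \<infinity>")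
  case True
  show ?thesis
    using True cgf_eq_ln_expectation[OF assms True] expectation_exp_pos[OF assms True]
    by (simp add: expectation_exp_shifted ln_div)
next
  case False
  then show ?thesis by (simp add: cgf_def less_top[symmetric])
qed

lemma mgf_0: "mgf M X 0 = 1"
  by (simp add: mgf_def emeasure_space_1)

lemma cgf_0: "cgf M X 0 = 0"
  by (simp add: cgf_def mgf_0)

lemma rate_function_nonneg: "0 \<le> rate_function M X t"
  unfolding rate_function_def by (rule SUP_upper2[of 0]) (auto simp: cgf_0)

text \<open>Jensen's inequality, obtained by integrating \<open>1 + u \<le> exp u\<close> at \<open>u = \<xi> (X - E[X])\<close>.\<close>

lemma expectation_times_le_cgf:
  assumes X [measurable]: "X \<in> borel_measurable M" and int: "integrable M X"
  shows "ereal (\<xi> * expectation X) \<le> cgf M X \<xi>"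
proof (cases "mgf M X \<xi> < \<infinity>")
  case True
  let ?m = "expectation X"
  have "(\<integral>x. 1 + \<xi> * (X x - ?m) \<partial>M) \<le> expectation (\<lambda>x. exp (\<xi> * (X x - ?m)))"
    using int integrable_exp_shifted[OF X True]
    by (intro integral_mono) auto
  moreover have "(\<integral>x. 1 + \<xi> * (X x - ?m) \<partial>M) = 1"
    using int by (simp add: prob_space)
  ultimately have "exp (\<xi> * ?m) \<le> expectation (\<lambda>x. exp (\<xi> * X x))"
    by (simp add: expectation_exp_shifted)
  then show ?thesis
    using expectation_exp_pos[OF X True] cgf_eq_ln_expectation[OF X True]
    by (simp add: ln_ge_iff)
next
  case False
  then show ?thesis by (simp add: cgf_def less_top[symmetric])
qed

text \<open>
  The rate function is a supremum over all \<open>\<theta>\<close>, so the bound is needed for each of them. Where the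
  exponential weight is at least \<open>1\<close> on \<open>A\<close>, it is Markov's inequality; for the other
  \<open>\<theta>\<close> the second alternative makes the exponent nonpositive, and the bound holds because probabilities
  are at most \<open>1\<close>. One statement thereby covers upper and lower tails.
\<close>

lemma chernoff:
  assumes Y [measurable]: "Y \<in> borel_measurable M" and A [measurable]: "A \<in> events"
    and cond: "\<And>\<theta>. (\<forall>x\<in>A. \<theta> * s \<le> \<theta> * Y x) \<or> ereal (\<theta> * s) \<le> cgf M Y \<theta>"
  shows "ereal (prob A) \<le> exp_ereal (- rate_function M Y s)"
proof (cases "prob A = 0")
  case False
  then have p: "0 < prob A" by (simp add: zero_less_measure_iff)
  have "ereal (\<theta> * s) - cgf M Y \<theta> \<le> ereal (- ln (prob A))" for \<theta>
  proof (cases "mgf M Y \<theta> < \<infinity>")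
    case True
    let ?\<phi> = "expectation (\<lambda>x. exp (\<theta> * (Y x - s)))"
    have pos: "0 < ?\<phi>" by (rule expectation_exp_shifted_pos[OF Y True])
    have "prob A \<le> ?\<phi>"
    proof (cases "\<forall>x\<in>A. \<theta> * s \<le> \<theta> * Y x")
      case True': True
      have "expectation (indicator A) \<le> ?\<phi>"
        using True' integrable_exp_shifted[OF Y True, of s] A
        by (intro integral_mono)
           (auto simp: indicator_def right_diff_distrib emeasure_eq_measure
                 simp del: integrable_indicator_iff
                 intro!: integrable_real_indicator)
      then show ?thesis by simp
    next
      case False
      then have "ereal (\<theta> * s) \<le> cgf M Y \<theta>" using cond[of \<theta>] by blast
      then have "exp (\<theta> * s) \<le> expectation (\<lambda>x. exp (\<theta> * Y x))"
        using expectation_exp_pos[OF Y True] cgf_eq_ln_expectation[OF Y True]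
        by (simp add: ln_ge_iff)
      then have "1 \<le> ?\<phi>" by (simp add: expectation_exp_shifted)
      then show ?thesis using prob_le_1[of A] by linarith
    qed
    then show ?thesis
      using True pos p by (simp add: legendre_objective[OF Y])
  qed (simp add: legendre_objective[OF Y])
  then have "rate_function M Y s \<le> ereal (- ln (prob A))"
    unfolding rate_function_def by (intro SUP_least)
  then have "exp_ereal (ereal (ln (prob A))) \<le> exp_ereal (- rate_function M Y s)"
    by (intro exp_ereal_mono) (cases "rate_function M Y s"; auto)
  then show ?thesis using p by simp
qed (simp flip: zero_ereal_def)

section \<open>Exponential tilting\<close>

lemma mgf_tilted_law:
  assumes X [measurable]: "X \<in> borel_measurable M"
  shows "mgf (tilted_law M X \<xi>) (\<lambda>u. u) \<theta> = mgf M X (\<xi> + \<theta>) / mgf M X \<xi>"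
proof -
  have "mgf (tilted_law M X \<xi>) (\<lambda>u. u) \<theta> =
      (\<integral>\<^sup>+ x. ennreal (exp (\<xi> * X x)) / mgf M X \<xi> * ennreal (exp (\<theta> * X x)) \<partial>M)"
    unfolding tilted_law_def
    by (simp add: mgf_def[of "density _ _"] nn_integral_density nn_integral_distr)
  also have "\<dots> = (\<integral>\<^sup>+ x. ennreal (exp ((\<xi> + \<theta>) * X x)) / mgf M X \<xi> \<partial>M)"
    by (intro nn_integral_cong)
       (simp add: ennreal_times_divide ennreal_divide_times distrib_right exp_add ennreal_mult)
  also have "\<dots> = mgf M X (\<xi> + \<theta>) / mgf M X \<xi>"
    unfolding mgf_def by (subst nn_integral_divide) auto
  finally show ?thesis .
qed

lemma sets_tilted_law [simp, measurable_cong]: "sets (tilted_law M X \<xi>) = sets borel"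
  by (simp add: tilted_law_def)

lemma space_tilted_law [simp]: "space (tilted_law M X \<xi>) = UNIV"
  by (simp add: tilted_law_def)

lemma prob_space_tilted_law:
  assumes X: "X \<in> borel_measurable M" and fin: "mgf M X \<xi> < \<infinity>"
  shows "prob_space (tilted_law M X \<xi>)"
proof
  have "emeasure (tilted_law M X \<xi>) (space (tilted_law M X \<xi>)) =
      mgf (tilted_law M X \<xi>) (\<lambda>u. u) 0"
    by (simp add: mgf_def)
  also have "\<dots> = 1"
    using mgf_pos[OF X, of \<xi>] fin
    by (simp add: mgf_tilted_law[OF X] ennreal_divide_self less_top[symmetric])
  finally show "emeasure (tilted_law M X \<xi>) (space (tilted_law M X \<xi>)) = 1" .
qed

lemma cgf_tilted_law:
  assumes X: "X \<in> borel_measurable M" and fin: "mgf M X \<xi> < \<infinity>"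
  shows "cgf (tilted_law M X \<xi>) (\<lambda>u. u) \<theta> = cgf M X (\<xi> + \<theta>) - cgf M X \<xi>"
proof (cases "mgf M X (\<xi> + \<theta>) < \<infinity>")
  case True
  have "mgf (tilted_law M X \<xi>) (\<lambda>u. u) \<theta> = ennreal
      (expectation (\<lambda>x. exp ((\<xi> + \<theta>) * X x)) / expectation (\<lambda>x. exp (\<xi> * X x)))"
    using expectation_exp_pos[OF X fin] expectation_exp_pos[OF X True]
    by (simp add: mgf_tilted_law[OF X] mgf_eq_expectation[OF X fin]
        mgf_eq_expectation[OF X True] divide_ennreal)
  then show ?thesis
    using expectation_exp_pos[OF X fin] expectation_exp_pos[OF X True]
    by (simp add: cgf_def[of "tilted_law M X \<xi>"] cgf_eq_ln_expectation[OF X fin]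
        cgf_eq_ln_expectation[OF X True] ln_div)
next
  case False
  then have "mgf M X (\<xi> + \<theta>) = \<infinity>" by (simp add: less_top[symmetric])
  then show ?thesis
    using fin
    by (simp add: cgf_def[of "tilted_law M X \<xi>"] mgf_tilted_law[OF X]
        cgf_eq_ln_expectation[OF X fin] cgf_def[of M X "\<xi> + \<theta>"] ennreal_top_divide)
qed

text \<open>
  A maximizer over \<open>\<xi> \<ge> 0\<close> is a maximizer over all reals: by Jensen's inequality the objective is at
  most \<open>\<xi> (t - E[X]) \<le> 0\<close> for \<open>\<xi> < 0\<close>, while it is \<open>0\<close> at \<open>0\<close>. Global maximality, read relative to
  the tilted law, is the statement that \<open>t\<close> is a subgradient of its cumulant function at \<open>0\<close>.
\<close>

lemma legendre_attained:
  assumes X: "X \<in> borel_measurable M" and int: "integrable M X" and t: "expectation X < t"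
    and max: "is_arg_max (\<lambda>\<xi>. ereal (\<xi> * t) - cgf M X \<xi>) (\<lambda>\<xi>. 0 \<le> \<xi>) \<xi>"
  shows legendre_attained_finite: "mgf M X \<xi> < \<infinity>"
    and legendre_attained_rate: "rate_function M X t = ereal (\<xi> * t) - cgf M X \<xi>"
    and legendre_attained_support: "ereal (\<theta> * t) \<le> cgf (tilted_law M X \<xi>) (\<lambda>u. u) \<theta>"
proof -
  let ?f = "\<lambda>\<xi>. ereal (\<xi> * t) - cgf M X \<xi>"
  have le_nonneg: "?f \<xi>' \<le> ?f \<xi>" if "0 \<le> \<xi>'" for \<xi>'
    using max that by (auto simp: is_arg_max_def not_less)
  have f0: "0 \<le> ?f \<xi>" using le_nonneg[of 0] by (simp add: cgf_0 flip: zero_ereal_def)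
  then show fin: "mgf M X \<xi> < \<infinity>" by (auto simp: legendre_objective[OF X] split: if_splits)
  have le: "?f \<xi>' \<le> ?f \<xi>" for \<xi>'
  proof (cases "0 \<le> \<xi>'")
    case False
    then have "ereal (\<xi>' * t) \<le> ereal (\<xi>' * expectation X)"
      using t by (simp add: mult_left_mono_neg)
    also have "\<dots> \<le> cgf M X \<xi>'" by (rule expectation_times_le_cgf[OF X int])
    finally have "?f \<xi>' \<le> 0" by (cases "cgf M X \<xi>'") auto
    then show ?thesis using f0 by (rule order_trans)
  qed (rule le_nonneg)
  show "rate_function M X t = ?f \<xi>"
    unfolding rate_function_def by (intro antisym SUP_least SUP_upper2[of \<xi>] le) auto
  show "ereal (\<theta> * t) \<le> cgf (tilted_law M X \<xi>) (\<lambda>u. u) \<theta>"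
    using le[of "\<xi> + \<theta>"] unfolding cgf_tilted_law[OF X fin] cgf_eq_ln_expectation[OF X fin]
    by (cases "cgf M X (\<xi> + \<theta>)") (auto simp: algebra_simps)
qed

lemma legendre_dual_cases:
  assumes "expectation X < t"
  obtains (attained) \<xi> where
      "is_arg_max (\<lambda>\<xi>. ereal (\<xi> * t) - cgf M X \<xi>) (\<lambda>\<xi>. 0 \<le> \<xi>) \<xi>"
      "legendre_dual M X t = ereal \<xi>"
    | (not_attained)
      "\<nexists>\<xi>. is_arg_max (\<lambda>\<xi>. ereal (\<xi> * t) - cgf M X \<xi>) (\<lambda>\<xi>. 0 \<le> \<xi>) \<xi>"
      "legendre_dual M X t = \<infinity>"
proof (cases "\<exists>\<xi>. is_arg_max (\<lambda>\<xi>. ereal (\<xi> * t) - cgf M X \<xi>) (\<lambda>\<xi>. 0 \<le> \<xi>) \<xi>")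
  case True
  then have "is_arg_max (\<lambda>\<xi>. ereal (\<xi> * t) - cgf M X \<xi>) (\<lambda>\<xi>. 0 \<le> \<xi>)
      (arg_max (\<lambda>\<xi>. ereal (\<xi> * t) - cgf M X \<xi>) (\<lambda>\<xi>. 0 \<le> \<xi>))"
    unfolding arg_max_def by (rule someI_ex)
  then show ?thesis using attained assms True by (simp add: legendre_dual_def)
next
  case False
  then show ?thesis using not_attained assms by (auto simp: legendre_dual_def Let_def)
qed

text \<open>
  The change of measure: for \<open>\<xi> \<ge> 0\<close> the tilting density on \<open>[a, b]\<close> is largest at the right endpoint.
\<close>

lemma tilted_interval_le:
  assumes X [measurable]: "X \<in> borel_measurable M" and fin: "mgf M X \<xi> < \<infinity>" and "0 \<le> \<xi>"
  shows "measure (tilted_law M X \<xi>) {a..b} * exp (- (\<xi> * b)) * expectation (\<lambda>x. exp (\<xi> * X x))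
    \<le> prob {x \<in> space M. a \<le> X x}"
proof -
  let ?N = "tilted_law M X \<xi>" and ?g = "expectation (\<lambda>x. exp (\<xi> * X x))"
  interpret N: prob_space ?N by (rule prob_space_tilted_law[OF X fin])
  have g: "0 < ?g" by (rule expectation_exp_pos[OF X fin])
  have "emeasure ?N {a..b} =
      (\<integral>\<^sup>+ x. ennreal (exp (\<xi> * X x)) / mgf M X \<xi> * indicator {a..b} (X x) \<partial>M)"
    unfolding tilted_law_def by (subst emeasure_density) (auto simp: nn_integral_distr)
  also have "\<dots> \<le> (\<integral>\<^sup>+ x. ennreal (exp (\<xi> * b) / ?g) * indicator {x \<in> space M. a \<le> X x} x \<partial>M)"
    using g \<open>0 \<le> \<xi>\<close>
    unfolding mgf_eq_expectation[OF X fin]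
    by (intro nn_integral_mono)
       (auto simp: divide_ennreal indicator_def
             intro!: ennreal_leI divide_right_mono mult_left_mono)
  also have "\<dots> = ennreal (exp (\<xi> * b) / ?g * prob {x \<in> space M. a \<le> X x})"
    using g by (subst nn_integral_cmult_indicator) (auto simp: emeasure_eq_measure simp flip: ennreal_mult)
  finally have "measure ?N {a..b} \<le> exp (\<xi> * b) / ?g * prob {x \<in> space M. a \<le> X x}"
    using g by (simp add: N.emeasure_eq_measure)
  then show ?thesis using g by (simp add: field_simps exp_minus)
qed

end
section \<open>Uniqueness of the subgradient at an interior point\<close>

text \<open>
  A bound quadratic in \<open>h\<close>; integrated over \<open>x = \<eta> Y\<close>, its constant is an exponential moment of \<open>Y\<close>.
  It follows from \<open>cosh v - 1 = 2 sinh\<^sup>2 (v / 2)\<close> and from the convexity of \<open>sinh\<close> on the positive half-line.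
\<close>

lemma cosh_scale_le:
  fixes h x :: real
  assumes "0 \<le> h" "h \<le> 1"
  shows "cosh (h * x) - 1 \<le> h\<^sup>2 * (cosh x - 1)"
proof -
  define u where "u = \<bar>x\<bar> / 2"
  have u: "0 \<le> u" by (simp add: u_def)
  have "h * sinh 0 - sinh (h * 0) \<le> h * sinh u - sinh (h * u)"
  proof (rule DERIV_nonneg_imp_nondecreasing[OF u])
    fix v :: real assume v: "0 \<le> v" "v \<le> u"
    have "((\<lambda>v. h * sinh v - sinh (h * v)) has_real_derivative h * cosh v - cosh (h * v) * h) (at v)"
      by (auto intro!: derivative_eq_intros)
    moreover have "cosh (h * v) \<le> cosh v"
      using assms v by (simp add: cosh_real_nonneg_le_iff mult_left_le_one_le)
    then have "0 \<le> h * cosh v - cosh (h * v) * h"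
      using assms by (simp add: mult.commute mult_left_mono)
    ultimately show "\<exists>d. ((\<lambda>v. h * sinh v - sinh (h * v)) has_real_derivative d) (at v) \<and> 0 \<le> d"
      by blast
  qed
  then have "sinh (h * u) \<le> h * sinh u" by simp
  then have sq: "(sinh (h * u))\<^sup>2 \<le> (h * sinh u)\<^sup>2"
    using assms u by (intro power_mono) auto
  have half: "cosh (k * x) - 1 = 2 * (sinh (k * u))\<^sup>2" if "0 \<le> k" for k
  proof -
    have "cosh (k * x) = cosh (2 * (k * u))"
      by (cases "0 \<le> x") (auto simp: u_def)
    then show ?thesis by (simp add: cosh_double cosh_square_eq)
  qed
  show ?thesis
    using sq half[OF assms(1)] half[of 1] by (simp add: power_mult_distrib)
qed

context prob_space
begin

text \<open>
  Finite exponential moments on both sides of \<open>0\<close> make the cumulant function differentiable there, so two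
  subgradients agree. Quantitatively, a gap \<open>b - a > 0\<close> gives a kink: \<open>E[exp(\<theta> Y)] + E[exp(- \<theta> Y)]\<close>
  exceeds \<open>2\<close> by at least \<open>\<theta> (b - a)\<close>, whereas \<open>cosh_scale_le\<close> bounds the excess by a multiple
  of \<open>\<theta>\<^sup>2\<close>.
\<close>

lemma support_slope_unique:
  assumes Y: "Y \<in> borel_measurable M" and \<eta>: "0 < \<eta>"
    and fin: "\<And>\<theta>. \<bar>\<theta>\<bar> \<le> \<eta> \<Longrightarrow> mgf M Y \<theta> < \<infinity>"
    and a: "\<And>\<theta>. ereal (\<theta> * a) \<le> cgf M Y \<theta>" and b: "\<And>\<theta>. ereal (\<theta> * b) \<le> cgf M Y \<theta>"
  shows "b \<le> a"
proof (rule ccontr)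
  assume "\<not> b \<le> a"
  define d where "d = \<eta> * (b - a)"
  have d: "0 < d" using \<eta> \<open>\<not> b \<le> a\<close> by (simp add: d_def)
  define C where "C = 2 * expectation (\<lambda>x. cosh (\<eta> * Y x) - 1)"
  have C: "0 \<le> C" by (simp add: C_def cosh_real_ge_1 integral_nonneg)
  have int_exp: "integrable M (\<lambda>x. exp (\<theta> * Y x))" if "\<bar>\<theta>\<bar> \<le> \<eta>" for \<theta>
    using integrable_exp[OF Y fin[OF that]] .
  have int_cosh: "integrable M (\<lambda>x. cosh (\<theta> * Y x))" if "\<bar>\<theta>\<bar> \<le> \<eta>" for \<theta>
    using int_exp[OF that] int_exp[of "- \<theta>"] that by (simp add: cosh_field_def)
  have lower: "1 + \<theta> * c \<le> expectation (\<lambda>x. exp (\<theta> * Y x))"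
    if "\<bar>\<theta>\<bar> \<le> \<eta>" "ereal (\<theta> * c) \<le> cgf M Y \<theta>" for \<theta> c
  proof -
    have "exp (\<theta> * c) \<le> expectation (\<lambda>x. exp (\<theta> * Y x))"
      using that cgf_eq_ln_expectation[OF Y fin] expectation_exp_pos[OF Y fin]
      by (simp add: ln_ge_iff)
    then show ?thesis using exp_ge_add_one_self[of "\<theta> * c"] by linarith
  qed
  have key: "h * d \<le> h\<^sup>2 * C" if h: "0 \<le> h" "h \<le> 1" for h
  proof -
    have h\<eta>: "\<bar>h * \<eta>\<bar> \<le> \<eta>" using h \<eta> by (simp add: abs_mult mult_left_le_one_le)
    have "2 + h * d = (1 + (h * \<eta>) * b) + (1 + (- (h * \<eta>)) * a)"
      by (simp add: d_def algebra_simps)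
    also have "\<dots> \<le> expectation (\<lambda>x. exp ((h * \<eta>) * Y x)) + expectation (\<lambda>x. exp (- (h * \<eta>) * Y x))"
      using h\<eta> by (intro add_mono lower a b) auto
    also have "\<dots> = expectation (\<lambda>x. 2 + 2 * (cosh (h * (\<eta> * Y x)) - 1))"
      using int_exp[OF h\<eta>] int_exp[of "- (h * \<eta>)"] h\<eta>
      by (subst Bochner_Integration.integral_add[symmetric])
         (auto simp: cosh_field_def mult.assoc)
    also have "\<dots> \<le> expectation (\<lambda>x. 2 + 2 * (h\<^sup>2 * (cosh (\<eta> * Y x) - 1)))"
    proof (rule integral_mono)
      fix x
      show "2 + 2 * (cosh (h * (\<eta> * Y x)) - 1) \<le> 2 + 2 * (h\<^sup>2 * (cosh (\<eta> * Y x) - 1))"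
        by (intro add_left_mono mult_left_mono cosh_scale_le h) simp
    qed (use int_cosh[of \<eta>] int_cosh[OF h\<eta>] \<eta> in \<open>auto simp: mult.assoc\<close>)
    also have "\<dots> = 2 + h\<^sup>2 * C"
      using int_cosh[of \<eta>] \<eta> by (simp add: C_def prob_space)
    finally show ?thesis by simp
  qed
  \<comment> \<open>any \<open>h\<close> in \<open>(0, 1]\<close> with \<open>h C < d\<close> contradicts \<open>key\<close>\<close>
  have "d / (C + d) * d \<le> (d / (C + d))\<^sup>2 * C"
    using C d by (intro key) auto
  then have "d \<le> d / (C + d) * C"
    using C d by (simp add: power2_eq_square divide_simps)
  then show False using C d mult_pos_pos[OF d d] by (simp add: field_simps)
qed

section \<open>Attainment slightly beyond the threshold\<close>

text \<open>
  With equal values at three equidistant points, the second difference vanishes; but it is the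
  expectation of the nonnegative variable \<open>exp(\<xi> (X - y)) (exp(\<eta> (X - y)) - 1)\<^sup>2\<close>. This is the part of
  strict convexity that is needed.
\<close>

lemma AE_eq_const_if_mgf_equidistant:
  assumes X: "X \<in> borel_measurable M" and "\<eta> \<noteq> 0"
    and fin: "\<And>k. k \<le> 2 \<Longrightarrow> mgf M X (\<xi> + real k * \<eta>) < \<infinity>"
    and eq: "\<And>k. k \<le> 2 \<Longrightarrow> expectation (\<lambda>x. exp ((\<xi> + real k * \<eta>) * (X x - y))) = c"
  shows "AE x in M. X x = y"
proof -
  note [measurable] = X
  let ?e = "\<lambda>k x. exp ((\<xi> + real k * \<eta>) * (X x - y))"
  let ?q = "\<lambda>x. ?e 2 x - 2 * ?e 1 x + ?e 0 x"
  have q: "?q x = exp (\<xi> * (X x - y)) * (exp (\<eta> * (X x - y)) - 1)\<^sup>2" for x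
    by (simp add: power2_eq_square algebra_simps flip: exp_add)
  have int: "integrable M (?e k)" if "k \<le> 2" for k
    using integrable_exp_shifted[OF X fin[OF that]] .
  have "expectation ?q = 0"
    using int[of 0] int[of 1] int[of 2] eq[of 0] eq[of 1] eq[of 2]
    by simp
  moreover have "integrable M ?q"
    using int[of 0] int[of 1] int[of 2] by simp
  moreover have "AE x in M. 0 \<le> ?q x"
    unfolding q by simp
  ultimately have "AE x in M. ?q x = 0"
    by (simp add: integral_nonneg_eq_0_iff_AE)
  then show ?thesis
    unfolding q using \<open>\<eta> \<noteq> 0\<close> by simp
qed

lemma convex_on_expectation_exp:
  assumes X: "X \<in> borel_measurable M" and "convex S" and fin: "\<And>\<xi>. \<xi> \<in> S \<Longrightarrow> mgf M X \<xi> < \<infinity>"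
  shows "convex_on S (\<lambda>\<xi>. expectation (\<lambda>x. exp (\<xi> * (X x - t))))"
proof (rule convex_onI)
  fix s \<xi> \<xi>' :: real
  assume s: "0 < s" "s < 1" and S: "\<xi> \<in> S" "\<xi>' \<in> S"
  note int = integrable_exp_shifted[OF X fin]
  have mem: "(1 - s) *\<^sub>R \<xi> + s *\<^sub>R \<xi>' \<in> S"
    using s S \<open>convex S\<close> by (auto simp: convex_alt)
  have "expectation (\<lambda>x. exp (((1 - s) *\<^sub>R \<xi> + s *\<^sub>R \<xi>') * (X x - t))) \<le>
      expectation (\<lambda>x. (1 - s) * exp (\<xi> * (X x - t)) + s * exp (\<xi>' * (X x - t)))"
  proof (intro integral_mono int mem)
    fix x
    show "exp (((1 - s) *\<^sub>R \<xi> + s *\<^sub>R \<xi>') * (X x - t)) \<le>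
        (1 - s) * exp (\<xi> * (X x - t)) + s * exp (\<xi>' * (X x - t))"
      using convex_onD[OF exp_convex, of s "\<xi> * (X x - t)" "\<xi>' * (X x - t)"] s
      by (simp add: algebra_simps)
  qed (use int[OF S(1)] int[OF S(2)] in auto)
  then show "expectation (\<lambda>x. exp (((1 - s) *\<^sub>R \<xi> + s *\<^sub>R \<xi>') * (X x - t))) \<le>
      (1 - s) * expectation (\<lambda>x. exp (\<xi> * (X x - t))) + s * expectation (\<lambda>x. exp (\<xi>' * (X x - t)))"
    using int[OF S(1)] int[OF S(2)] by simp
qed (rule \<open>convex S\<close>)

text \<open>
  The minimized function \<open>\<phi> t \<xi> = E[exp(\<xi> (X - t))]\<close> satisfies
  \<open>\<phi> y \<zeta>' > \<phi> y \<xi>\<^sub>y\<close> at some \<open>\<zeta>'\<close> strictly between \<open>\<xi>\<^sub>y\<close> and \<open>\<zeta>\<close>, and this strict inequality survives for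
  some \<open>t > y\<close>. Convexity then keeps \<open>\<phi> t\<close> above \<open>\<phi> t \<xi>\<^sub>y\<close> on all of \<open>[\<zeta>', \<infinity>)\<close>, so that the
  minimum over the compact interval \<open>[0, \<zeta>']\<close> is global and every minimizer lies left of \<open>\<zeta>'\<close>.
\<close>

lemma legendre_attained_beyond:
  assumes X: "X \<in> borel_measurable M" and y: "expectation X < y"
    and max: "is_arg_max (\<lambda>\<xi>. ereal (\<xi> * y) - cgf M X \<xi>) (\<lambda>\<xi>. 0 \<le> \<xi>) \<xi>\<^sub>y"
    and \<zeta>: "\<xi>\<^sub>y < \<zeta>" and fin: "\<And>\<xi>. \<xi> \<le> \<zeta> \<Longrightarrow> mgf M X \<xi> < \<infinity>"
  obtains t where "y < t"
    "\<exists>\<xi>. is_arg_max (\<lambda>\<xi>. ereal (\<xi> * t) - cgf M X \<xi>) (\<lambda>\<xi>. 0 \<le> \<xi>) \<xi>"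
    "\<And>\<xi>. is_arg_max (\<lambda>\<xi>. ereal (\<xi> * t) - cgf M X \<xi>) (\<lambda>\<xi>. 0 \<le> \<xi>) \<xi> \<Longrightarrow> \<xi> < \<zeta>"
proof -
  define \<phi> where "\<phi> t \<xi> = expectation (\<lambda>x. exp (\<xi> * (X x - t)))" for t \<xi>
  let ?f = "\<lambda>t \<xi>. ereal (\<xi> * t) - cgf M X \<xi>"
  have \<phi>_pos: "0 < \<phi> t \<xi>" if "mgf M X \<xi> < \<infinity>" for t \<xi>
    unfolding \<phi>_def by (rule expectation_exp_shifted_pos[OF X that])
  have f_le: "?f t \<xi> \<le> ?f t \<xi>' \<longleftrightarrow> \<phi> t \<xi>' \<le> \<phi> t \<xi>"
    if "mgf M X \<xi> < \<infinity>" "mgf M X \<xi>' < \<infinity>" for t \<xi> \<xi>'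
    using that \<phi>_pos[of \<xi> t] \<phi>_pos[of \<xi>' t]
    by (simp add: legendre_objective[OF X] \<phi>_def)
  have \<xi>y: "0 \<le> \<xi>\<^sub>y" and le_y: "\<And>\<xi>. 0 \<le> \<xi> \<Longrightarrow> ?f y \<xi> \<le> ?f y \<xi>\<^sub>y"
    using max by (auto simp: is_arg_max_def not_less)
  \<comment> \<open>one third, so that both \<open>\<xi>\<^sub>y + \<eta>\<close> and \<open>\<xi>\<^sub>y + 2 \<eta>\<close> stay strictly left of \<open>\<zeta>\<close>, where
    \<open>\<phi> t\<close> is continuous\<close>
  define \<eta> where "\<eta> = (\<zeta> - \<xi>\<^sub>y) / 3"
  have \<eta>: "0 < \<eta>" "\<xi>\<^sub>y + 2 * \<eta> < \<zeta>" using \<zeta> by (simp_all add: \<eta>_def field_simps)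
  have fin_k: "mgf M X (\<xi>\<^sub>y + real k * \<eta>) < \<infinity>" if "k \<le> 2" for k
  proof -
    have "real k * \<eta> \<le> 2 * \<eta>" using that \<eta> by (intro mult_right_mono) auto
    then show ?thesis using \<eta> by (intro fin) linarith
  qed
  have "\<exists>k\<le>2. \<phi> y (\<xi>\<^sub>y + real k * \<eta>) \<noteq> \<phi> y \<xi>\<^sub>y"
  proof (rule ccontr)
    assume "\<not> ?thesis"
    then have "\<phi> y (\<xi>\<^sub>y + real k * \<eta>) = \<phi> y \<xi>\<^sub>y" if "k \<le> 2" for k
      using that by blast
    then have "AE x in M. X x = y"
      using \<eta> fin_k unfolding \<phi>_def
      by (intro AE_eq_const_if_mgf_equidistant[OF X, where \<eta> = \<eta> and \<xi> = \<xi>\<^sub>y]) auto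
    then have "expectation X = expectation (\<lambda>_. y)"
      by (intro integral_cong_AE) (use X in auto)
    then show False using y by (simp add: prob_space)
  qed
  then obtain k where k: "k \<le> 2" "\<phi> y (\<xi>\<^sub>y + real k * \<eta>) \<noteq> \<phi> y \<xi>\<^sub>y" by blast
  define \<zeta>' where "\<zeta>' = \<xi>\<^sub>y + real k * \<eta>"
  have "k \<noteq> 0" using k by (auto intro: Nat.gr0I)
  then have \<zeta>': "\<xi>\<^sub>y < \<zeta>'" using \<eta> by (simp add: \<zeta>'_def)
  have "real k * \<eta> \<le> 2 * \<eta>" using k \<eta> by (intro mult_right_mono) auto
  then have \<zeta>'_less: "\<zeta>' < \<zeta>" using \<eta> unfolding \<zeta>'_def by linarith
  have fin': "mgf M X \<zeta>' < \<infinity>" "mgf M X \<xi>\<^sub>y < \<infinity>" using fin \<zeta> \<zeta>'_less by auto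
  have strict: "\<phi> y \<xi>\<^sub>y < \<phi> y \<zeta>'"
    using le_y[of \<zeta>'] f_le[OF fin', of y] \<xi>y \<zeta>' k by (simp add: \<zeta>'_def)
  have ln_\<phi>: "ln (\<phi> t \<xi>) = ln (\<phi> y \<xi>) - \<xi> * (t - y)" if "mgf M X \<xi> < \<infinity>" for t \<xi>
    using expectation_exp_pos[OF X that]
    unfolding \<phi>_def expectation_exp_shifted by (simp add: ln_div right_diff_distrib)
  \<comment> \<open>halfway between \<open>y\<close> and the slope at which \<open>\<phi> t\<close> takes equal values at \<open>\<xi>\<^sub>y\<close> and \<open>\<zeta>'\<close>\<close>
  define t where "t = y + (ln (\<phi> y \<zeta>') - ln (\<phi> y \<xi>\<^sub>y)) / (2 * (\<zeta>' - \<xi>\<^sub>y))"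
  have gap: "0 < ln (\<phi> y \<zeta>') - ln (\<phi> y \<xi>\<^sub>y)"
    using strict \<phi>_pos[OF fin'(1), of y] \<phi>_pos[OF fin'(2), of y] by simp
  have t: "y < t" using gap \<zeta>' by (simp add: t_def)
  have "(\<zeta>' - \<xi>\<^sub>y) * (t - y) = (ln (\<phi> y \<zeta>') - ln (\<phi> y \<xi>\<^sub>y)) / 2"
    using \<zeta>' unfolding t_def by (simp add: divide_simps)
  then have "ln (\<phi> t \<xi>\<^sub>y) < ln (\<phi> t \<zeta>')"
    unfolding ln_\<phi>[OF fin'(1), of t] ln_\<phi>[OF fin'(2), of t] using gap by (simp add: algebra_simps)
  then have strict_t: "\<phi> t \<xi>\<^sub>y < \<phi> t \<zeta>'"
    using \<phi>_pos[OF fin'(1), of t] \<phi>_pos[OF fin'(2), of t] by simp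
  have beyond: "?f t \<xi> < ?f t \<xi>\<^sub>y" if "\<zeta>' \<le> \<xi>" for \<xi>
  proof (cases "mgf M X \<xi> < \<infinity>")
    case True
    define s where "s = (\<zeta>' - \<xi>\<^sub>y) / (\<xi> - \<xi>\<^sub>y)"
    have s: "0 < s" "s \<le> 1" using \<zeta>' that by (auto simp: s_def)
    have "s * (\<xi> - \<xi>\<^sub>y) = \<zeta>' - \<xi>\<^sub>y" using \<zeta>' that by (simp add: s_def)
    then have \<zeta>'_eq: "\<zeta>' = (1 - s) * \<xi>\<^sub>y + s * \<xi>" by (simp add: algebra_simps)
    note int = integrable_exp_shifted[OF X, where t = t]
    have "\<phi> t \<zeta>' \<le> expectation (\<lambda>x. (1 - s) * exp (\<xi>\<^sub>y * (X x - t)) + s * exp (\<xi> * (X x - t)))"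
      unfolding \<phi>_def
    proof (rule integral_mono)
      fix x
      show "exp (\<zeta>' * (X x - t)) \<le> (1 - s) * exp (\<xi>\<^sub>y * (X x - t)) + s * exp (\<xi> * (X x - t))"
        using convex_onD[OF exp_convex, of s "\<xi>\<^sub>y * (X x - t)" "\<xi> * (X x - t)"] s
        by (simp add: \<zeta>'_eq algebra_simps)
    qed (use int[OF fin'(1)] int[OF fin'(2)] int[OF True] in auto)
    also have "\<dots> = (1 - s) * \<phi> t \<xi>\<^sub>y + s * \<phi> t \<xi>"
      using int[OF fin'(2)] int[OF True] by (simp add: \<phi>_def)
    finally have "\<phi> t \<xi>\<^sub>y < (1 - s) * \<phi> t \<xi>\<^sub>y + s * \<phi> t \<xi>" using strict_t by simp
    then have "s * \<phi> t \<xi>\<^sub>y < s * \<phi> t \<xi>" by (simp add: algebra_simps)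
    then have "\<phi> t \<xi>\<^sub>y < \<phi> t \<xi>" using s by simp
    then show ?thesis using f_le[OF fin'(2) True, of t] by (simp add: not_le[symmetric])
  qed (use fin' in \<open>simp add: legendre_objective[OF X]\<close>)
  have "convex_on {..<\<zeta>} (\<phi> t)"
    unfolding \<phi>_def using fin by (intro convex_on_expectation_exp[OF X]) auto
  then have "continuous_on {..<\<zeta>} (\<phi> t)" by (intro convex_on_continuous) auto
  then have "continuous_on {0..\<zeta>'} (\<phi> t)"
    using \<zeta>'_less by (elim continuous_on_subset) auto
  then obtain \<xi>\<^sub>t where \<xi>t: "\<xi>\<^sub>t \<in> {0..\<zeta>'}" "\<And>\<xi>. \<xi> \<in> {0..\<zeta>'} \<Longrightarrow> \<phi> t \<xi>\<^sub>t \<le> \<phi> t \<xi>"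
    using continuous_attains_inf[of "{0..\<zeta>'}" "\<phi> t"] \<xi>y \<zeta>' by auto
  have le_t: "?f t \<xi> \<le> ?f t \<xi>\<^sub>t" if "\<xi> \<in> {0..\<zeta>'}" for \<xi>
  proof -
    have "mgf M X \<xi> < \<infinity>" "mgf M X \<xi>\<^sub>t < \<infinity>"
      using that \<xi>t(1) \<zeta>'_less by (intro fin; simp)+
    then show ?thesis using f_le \<xi>t(2)[OF that] by blast
  qed
  have "is_arg_max (?f t) (\<lambda>\<xi>. 0 \<le> \<xi>) \<xi>\<^sub>t"
    unfolding is_arg_max_def
  proof (intro conjI notI)
    show "0 \<le> \<xi>\<^sub>t" using \<xi>t by simp
    assume "\<exists>\<xi>\<ge>0. ?f t \<xi>\<^sub>t < ?f t \<xi>"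
    then obtain \<xi> where \<xi>: "0 \<le> \<xi>" "?f t \<xi>\<^sub>t < ?f t \<xi>" by auto
    have "\<zeta>' < \<xi>" using le_t[of \<xi>] \<xi> by (meson atLeastAtMost_iff not_le)
    then have "?f t \<xi> < ?f t \<xi>\<^sub>y" by (intro beyond) simp
    also have "\<dots> \<le> ?f t \<xi>\<^sub>t" using \<xi>y \<zeta>' by (intro le_t) simp
    finally show False using \<xi>(2) by simp
  qed
  moreover have "\<xi> < \<zeta>" if "is_arg_max (?f t) (\<lambda>\<xi>. 0 \<le> \<xi>) \<xi>" for \<xi>
  proof (rule ccontr)
    assume "\<not> \<xi> < \<zeta>"
    then have "?f t \<xi> < ?f t \<xi>\<^sub>y" using \<zeta>'_less by (intro beyond) simp
    then show False using that \<xi>y by (auto simp: is_arg_max_def)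
  qed
  ultimately show thesis using t that by blast
qed

section \<open>The lower bound and its positivity\<close>

text \<open>
  With \<open>I\<^sub>\<mu>(\<alpha> y) = \<xi> \<alpha> y - log g(\<xi>)\<close> the terms in \<open>\<alpha>\<close> cancel in the exponent of \<open>L\<close>, which leaves
  \<open>log g(\<xi>) - \<xi> \<delta> y\<close>.
\<close>

lemma L_attained:
  assumes X: "X \<in> borel_measurable M" and int: "integrable M X"
    and max: "is_arg_max (\<lambda>\<xi>. ereal (\<xi> * (\<alpha> * y)) - cgf M X \<xi>) (\<lambda>\<xi>. 0 \<le> \<xi>) \<xi>"
    and dual: "legendre_dual M X (\<alpha> * y) = ereal \<xi>" and mean: "expectation X < \<alpha> * y"
  shows "L M X \<alpha> \<delta> y =
    (1 - exp_ereal (- rate_function (tilted_law M X \<xi>) (\<lambda>u. u) (\<delta> * y))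
       - exp_ereal (- rate_function (tilted_law M X \<xi>) (\<lambda>u. u) y)) *
    ereal (exp (- (\<xi> * (\<delta> * y))) * expectation (\<lambda>x. exp (\<xi> * X x)))"
proof -
  note fin = legendre_attained_finite[OF X int mean max]
  have "exp_ereal (- rate_function M X (\<alpha> * y) - ereal \<xi> * ereal y * ereal (\<delta> - \<alpha>)) =
      ereal (exp (ln (expectation (\<lambda>x. exp (\<xi> * X x))) - \<xi> * (\<delta> * y)))"
    unfolding legendre_attained_rate[OF X int mean max] cgf_eq_ln_expectation[OF X fin]
    by (simp add: algebra_simps)
  also have "\<dots> = ereal (exp (- (\<xi> * (\<delta> * y))) * expectation (\<lambda>x. exp (\<xi> * X x)))"
    using expectation_exp_pos[OF X fin] by (simp add: exp_diff exp_minus field_simps)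
  finally show ?thesis by (simp add: L_def dual tilted_rate_function_def)
qed

lemma L_not_attained:
  assumes "legendre_dual M X (\<alpha> * y) = \<infinity>" "0 < y" "\<alpha> < \<delta>"
  shows "L M X \<alpha> \<delta> y = 0"
proof -
  have "- rate_function M X (\<alpha> * y) - \<infinity> * ereal y * ereal (\<delta> - \<alpha>) = -\<infinity>"
    using assms rate_function_nonneg[of X "\<alpha> * y"]
    by (cases "rate_function M X (\<alpha> * y)") auto
  then show ?thesis by (simp add: L_def assms)
qed

lemma L_le_prob:
  assumes X [measurable]: "X \<in> borel_measurable M" and int: "integrable M X"
    and y: "0 < y" "expectation X < y" and \<alpha>: "1 < \<alpha>" "\<alpha> < \<delta>"
  shows "L M X \<alpha> \<delta> y \<le> ereal (prob {x \<in> space M. y \<le> X x})"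
proof -
  have mean: "expectation X < \<alpha> * y" using y \<alpha> by (smt (verit) mult_less_cancel_right1)
  show ?thesis
  proof (cases rule: legendre_dual_cases[OF mean])
    case (1 \<xi>)
    let ?N = "tilted_law M X \<xi>" and ?g = "expectation (\<lambda>x. exp (\<xi> * X x))"
    let ?I = "rate_function ?N (\<lambda>u. u)"
    note fin = legendre_attained_finite[OF X int mean 1(1)]
    interpret N: prob_space ?N by (rule prob_space_tilted_law[OF X fin])
    have support: "ereal (\<theta> * (\<alpha> * y)) \<le> cgf ?N (\<lambda>u. u) \<theta>" for \<theta>
      by (rule legendre_attained_support[OF X int mean 1(1)])
    have \<xi>: "0 \<le> \<xi>" using 1(1) by (simp add: is_arg_max_def)
    have upper: "ereal (measure ?N {\<delta> * y<..}) \<le> exp_ereal (- ?I (\<delta> * y))"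
    proof (rule N.chernoff)
      fix \<theta>
      show "(\<forall>u\<in>{\<delta> * y<..}. \<theta> * (\<delta> * y) \<le> \<theta> * u) \<or> ereal (\<theta> * (\<delta> * y)) \<le> cgf ?N (\<lambda>u. u) \<theta>"
      proof (cases "0 \<le> \<theta>")
        case False
        then have "ereal (\<theta> * (\<delta> * y)) \<le> ereal (\<theta> * (\<alpha> * y))"
          using \<alpha> y by (simp add: mult_left_mono_neg)
        then show ?thesis using support[of \<theta>] by (blast intro: order_trans)
      qed (auto intro: mult_left_mono)
    qed auto
    have lower: "ereal (measure ?N {..<y}) \<le> exp_ereal (- ?I y)"
    proof (rule N.chernoff)
      fix \<theta>
      show "(\<forall>u\<in>{..<y}. \<theta> * y \<le> \<theta> * u) \<or> ereal (\<theta> * y) \<le> cgf ?N (\<lambda>u. u) \<theta>"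
      proof (cases "\<theta> \<le> 0")
        case False
        then have "ereal (\<theta> * y) \<le> ereal (\<theta> * (\<alpha> * y))"
          using \<alpha> y by (simp add: mult_left_mono)
        then show ?thesis using support[of \<theta>] by (blast intro: order_trans)
      qed (auto intro: mult_left_mono_neg)
    qed auto
    have "UNIV = {y..\<delta> * y} \<union> {\<delta> * y<..} \<union> {..<y}" by auto
    then have "1 = measure ?N ({y..\<delta> * y} \<union> {\<delta> * y<..} \<union> {..<y})"
      using N.prob_space by simp
    also have "\<dots> \<le> measure ?N {y..\<delta> * y} + measure ?N {\<delta> * y<..} + measure ?N {..<y}"
      by (intro order_trans[OF measure_Un_le] add_right_mono) auto
    finally have mass: "1 - measure ?N {\<delta> * y<..} - measure ?N {..<y} \<le> measure ?N {y..\<delta> * y}"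
      by simp
    have "1 - exp_ereal (- ?I (\<delta> * y)) - exp_ereal (- ?I y)
        \<le> 1 - ereal (measure ?N {\<delta> * y<..}) - ereal (measure ?N {..<y})"
      by (intro ereal_minus_mono order_refl upper lower)
    also have "\<dots> \<le> ereal (measure ?N {y..\<delta> * y})"
      using mass by (simp add: one_ereal_def)
    finally have "L M X \<alpha> \<delta> y \<le> ereal (measure ?N {y..\<delta> * y}) * ereal (exp (- (\<xi> * (\<delta> * y))) * ?g)"
      unfolding L_attained[OF X int 1 mean]
      using expectation_exp_pos[OF X fin] by (intro ereal_mult_right_mono) auto
    also have "\<dots> \<le> ereal (prob {x \<in> space M. y \<le> X x})"
      using tilted_interval_le[OF X fin \<xi>, of y "\<delta> * y"] by (simp add: mult.assoc)
    finally show ?thesis .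
  next
    case 2
    then show ?thesis using L_not_attained[of X \<alpha> y \<delta>] y \<alpha> by (simp add: zero_ereal_def)
  qed
qed

lemma L_pos:
  assumes X [measurable]: "X \<in> borel_measurable M" and int: "integrable M X"
    and y: "0 < y" "expectation X < y"
    and dual: "legendre_dual M X y < ereal \<zeta>" and fin: "\<And>\<xi>. \<xi> \<le> \<zeta> \<Longrightarrow> mgf M X \<xi> < \<infinity>"
  shows "\<exists>\<alpha> \<delta>. 1 < \<alpha> \<and> \<alpha> < \<delta> \<and> 0 < L M X \<alpha> \<delta> y"
proof -
  obtain \<xi>\<^sub>y where \<xi>y: "is_arg_max (\<lambda>\<xi>. ereal (\<xi> * y) - cgf M X \<xi>) (\<lambda>\<xi>. 0 \<le> \<xi>) \<xi>\<^sub>y"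
      "legendre_dual M X y = ereal \<xi>\<^sub>y"
    by (cases rule: legendre_dual_cases[OF y(2)]) (use dual in auto)
  obtain t where t: "y < t"
      "\<exists>\<xi>. is_arg_max (\<lambda>\<xi>. ereal (\<xi> * t) - cgf M X \<xi>) (\<lambda>\<xi>. 0 \<le> \<xi>) \<xi>"
      "\<And>\<xi>. is_arg_max (\<lambda>\<xi>. ereal (\<xi> * t) - cgf M X \<xi>) (\<lambda>\<xi>. 0 \<le> \<xi>) \<xi> \<Longrightarrow> \<xi> < \<zeta>"
    using legendre_attained_beyond[OF X y(2) \<xi>y(1) _ fin] dual \<xi>y(2) by auto
  define \<alpha> where "\<alpha> = t / y"
  have \<alpha>: "1 < \<alpha>" "\<alpha> * y = t" using t y by (simp_all add: \<alpha>_def)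
  have mean: "expectation X < \<alpha> * y" using \<alpha> t y by simp
  obtain \<xi> where max: "is_arg_max (\<lambda>\<xi>. ereal (\<xi> * (\<alpha> * y)) - cgf M X \<xi>) (\<lambda>\<xi>. 0 \<le> \<xi>) \<xi>"
      and dual_\<alpha>: "legendre_dual M X (\<alpha> * y) = ereal \<xi>"
    by (cases rule: legendre_dual_cases[OF mean]) (use t \<alpha> in auto)
  have \<xi>: "\<xi> < \<zeta>" using t(3) max \<alpha> by simp
  let ?N = "tilted_law M X \<xi>" and ?g = "expectation (\<lambda>x. exp (\<xi> * X x))"
  let ?I = "rate_function ?N (\<lambda>u. u)"
  note fin_\<xi> = legendre_attained_finite[OF X int mean max]
  interpret N: prob_space ?N by (rule prob_space_tilted_law[OF X fin_\<xi>])
  define \<eta> where "\<eta> = \<zeta> - \<xi>"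
  have \<eta>: "0 < \<eta>" using \<xi> by (simp add: \<eta>_def)
  have fin_N: "mgf ?N (\<lambda>u. u) \<theta> < \<infinity>" if "\<theta> \<le> \<eta>" for \<theta>
  proof -
    have f: "mgf M X (\<xi> + \<theta>) < \<infinity>" using that by (intro fin) (simp add: \<eta>_def)
    show ?thesis
      using mgf_pos[OF X, of \<xi>] f
      by (auto simp: mgf_tilted_law[OF X] ennreal_divide_eq_top_iff less_top[symmetric])
  qed
  \<comment> \<open>otherwise \<open>y\<close> and \<open>\<alpha> y\<close> would both be subgradients at \<open>0\<close>\<close>
  have "\<exists>\<theta>. cgf ?N (\<lambda>u. u) \<theta> < ereal (\<theta> * y)"
  proof (rule ccontr)
    assume "\<not> ?thesis"
    then have "\<alpha> * y \<le> y"
      using fin_N legendre_attained_support[OF X int mean max]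
      by (intro N.support_slope_unique[of "\<lambda>u. u" \<eta>]) (auto simp: \<eta> not_less)
    then show False using \<alpha> t by simp
  qed
  then obtain \<theta> where "cgf ?N (\<lambda>u. u) \<theta> < ereal (\<theta> * y)" by blast
  then have "0 < ereal (\<theta> * y) - cgf ?N (\<lambda>u. u) \<theta>" by (cases "cgf ?N (\<lambda>u. u) \<theta>") auto
  also have "\<dots> \<le> ?I y" unfolding rate_function_def by (rule SUP_upper) simp
  finally have "exp_ereal (- ?I y) < 1" by (rule exp_ereal_uminus_less_1)
  then obtain e where e: "exp_ereal (- ?I y) = ereal e" "e < 1"
    using exp_ereal_nonneg[of "- ?I y"] by (cases "exp_ereal (- ?I y)") auto
  obtain c where c: "cgf ?N (\<lambda>u. u) \<eta> = ereal c"
    using N.cgf_eq_ln_expectation[of "\<lambda>u. u" \<eta>] fin_N[of \<eta>] by auto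
  \<comment> \<open>large enough that the single term \<open>\<theta> = \<eta>\<close> of the supremum makes \<open>exp(- I\<^sub>\<alpha>(\<delta> y))\<close> at most
    half of \<open>1 - e\<close>\<close>
  define \<delta> where "\<delta> = max (\<alpha> + 1) ((c - ln ((1 - e) / 2)) / (\<eta> * y))"
  have \<delta>: "\<alpha> < \<delta>" by (simp add: \<delta>_def)
  have "(c - ln ((1 - e) / 2)) / (\<eta> * y) \<le> \<delta>" by (simp add: \<delta>_def)
  then have "- ln ((1 - e) / 2) \<le> \<eta> * (\<delta> * y) - c"
    using \<eta> y by (simp add: divide_le_eq algebra_simps)
  then have "ereal (- ln ((1 - e) / 2)) \<le> ereal (\<eta> * (\<delta> * y)) - cgf ?N (\<lambda>u. u) \<eta>"
    by (simp add: c)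
  also have "\<dots> \<le> ?I (\<delta> * y)" unfolding rate_function_def by (rule SUP_upper) simp
  finally have "exp_ereal (- ?I (\<delta> * y)) \<le> exp_ereal (ereal (ln ((1 - e) / 2)))"
    by (intro exp_ereal_mono) (cases "?I (\<delta> * y)"; simp)
  then have "exp_ereal (- ?I (\<delta> * y)) \<le> ereal ((1 - e) / 2)"
    using e by simp
  then have "0 < 1 - exp_ereal (- ?I (\<delta> * y)) - exp_ereal (- ?I y)"
    using e exp_ereal_nonneg[of "- ?I (\<delta> * y)"]
    by (cases "exp_ereal (- ?I (\<delta> * y))") (auto simp: one_ereal_def field_simps)
  then have "0 < L M X \<alpha> \<delta> y"
    unfolding L_attained[OF X int max dual_\<alpha> mean]
    using expectation_exp_pos[OF X fin_\<xi>] by (simp add: ereal_zero_less_0_iff)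
  then show ?thesis using \<alpha> \<delta> by blast
qed

end

lemma mgf_finite_downward:
  assumes "AE x in M. 0 < X x" "\<xi> \<le> \<zeta>" "mgf M X \<zeta> < \<infinity>"
  shows "mgf M X \<xi> < \<infinity>"
proof -
  have "mgf M X \<xi> \<le> mgf M X \<zeta>"
    unfolding mgf_def
    using assms(1) by (intro nn_integral_mono_AE) (auto simp: \<open>\<xi> \<le> \<zeta>\<close> mult_right_mono)
  then show ?thesis using assms(3) by (rule le_less_trans)
qed

theorem theorem2p1:
  fixes M :: "'a measure" and X :: "'a \<Rightarrow> real" and \<xi>s :: ereal and y :: real
  assumes "prob_space M"
    and "X \<in> borel_measurable M"
    and "AE x in M. 0 < X x"
    and "0 < \<xi>s"
    and "\<And>\<xi>::real. ereal \<xi> < \<xi>s \<Longrightarrow> mgf M X \<xi> < \<infinity>"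
    and "integral\<^sup>L M X < y"
  shows "(SUP (\<alpha>, \<delta>) \<in> {(\<alpha>, \<delta>). 1 < \<alpha> \<and> \<alpha> < \<delta>}. L M X \<alpha> \<delta> y)
           \<le> ereal (measure M {x \<in> space M. y \<le> X x})
       \<and> ((\<exists>\<zeta>::real. legendre_dual M X y < ereal \<zeta> \<and> mgf M X \<zeta> < \<infinity>) \<longrightarrow>
            (\<exists>\<alpha> \<delta>. 1 < \<alpha> \<and> \<alpha> < \<delta> \<and> 0 < L M X \<alpha> \<delta> y))"
proof -
  interpret prob_space M by fact
  note X = assms(2) and pos = assms(3)
  obtain c :: real where c: "0 < c" "ereal c < \<xi>s"
    using ereal_dense2[OF assms(4)] by auto
  have "integrable M X"
  proof (rule Bochner_Integration.integrable_bound)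
    show "integrable M (\<lambda>x. exp (c * X x) / c)"
      using integrable_exp[OF X assms(5)[OF c(2)]] by simp
    show "AE x in M. norm (X x) \<le> norm (exp (c * X x) / c)"
      using pos
    proof eventually_elim
      case (elim x)
      have "c * X x \<le> exp (c * X x)"
        using exp_ge_add_one_self[of "c * X x"] by linarith
      then show ?case using elim c by (simp add: pos_le_divide_eq mult.commute)
    qed
  qed (rule X)
  moreover have "0 \<le> expectation X"
    using pos by (intro integral_nonneg_AE) auto
  then have "0 < y" using assms(6) by linarith
  ultimately show ?thesis
    using L_le_prob[OF X _ _ assms(6)] L_pos[OF X _ _ assms(6)] mgf_finite_downward[OF pos]
    by (auto intro!: SUP_least)
qed

end
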